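(* Let $E,F$ be Banach spaces and let $k$ be a nonnegative integer with $k<\dim F$. Then the set $$F_k=\{T\in B(E,F):\operatorname{rank}T=k\}$$ is path connected.
   Context: $B(E,F)$ denotes the set of all bounded linear operators from $E$ to $F$ with the operator norm. A set $S\subset B(E,F)$ is said to be path connected if for any two operators $T_0,T_1\in S$ there is a (norm-continuous) path $\omega(t)\in S$, $t\in[0,1]$, with $\omega(0)=T_0$ and $\omega(1)=T_1$. *)

theory Defs
  imports "HOL-Analysis.Analysis" "HOL-Library.Extended_Nat"
begin

text \<open>
  Banach spaces over \<open>\<real>\<close> or \<open>\<complex>\<close> are treated uniformly: by Frobenius' theorem, the types of sort
  \<open>{real_normed_field, euclidean_space}\<close> are, up to isomorphism of normed fields, exactly
  \<open>real\<close> and \<open>complex\<close>. Norm, topology and completeness come from the class \<open>banach\<close>; the scalar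
  multiplication is an explicit parameter that has to extend the real one.
\<close>

locale banach_space_over = vector_space scale
  for scale :: "'k::{real_normed_field,euclidean_space} \<Rightarrow> 'a::banach \<Rightarrow> 'a" +
  assumes scale_of_real: "scale (of_real r) x = r *\<^sub>R x"
    and norm_scale: "norm (scale c x) = norm c * norm x"

lemma banach_space_over_real: "banach_space_over ((*\<^sub>R) :: real \<Rightarrow> 'a::banach \<Rightarrow> 'a)"
  by unfold_locales (simp_all add: algebra_simps)

lemma banach_space_over_complex: "banach_space_over ((*) :: complex \<Rightarrow> complex \<Rightarrow> complex)"
  by unfold_locales (simp_all add: algebra_simps norm_mult scaleR_conv_of_real)

text \<open>
  The library's \<open>dim\<close> is \<open>0\<close> on infinite-dimensional subspaces, so the value \<open>\<infinity>\<close> is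
  made explicit.
\<close>

definition (in vector_space) edim :: "'b set \<Rightarrow> enat" where
  "edim V = (if \<exists>B. finite B \<and> V \<subseteq> span B then enat (dim V) else \<infinity>)"

text \<open>
  \<open>'a \<Rightarrow>\<^sub>L 'b\<close> consists of the bounded real-linear maps with the operator norm. The space
  \<open>B(E,F)\<close> is its subspace of maps that are linear over the scalar field; the operator norm does
  not depend on that field.
\<close>

definition bounded_operators ::
  "('k::field \<Rightarrow> 'a::real_normed_vector \<Rightarrow> 'a) \<Rightarrow> ('k \<Rightarrow> 'b::real_normed_vector \<Rightarrow> 'b)
    \<Rightarrow> ('a \<Rightarrow>\<^sub>L 'b) set" where
  "bounded_operators scaleE scaleF = {T. Vector_Spaces.linear scaleE scaleF (blinfun_apply T)}"

definition operator_rank ::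
  "('k::field \<Rightarrow> 'b::real_normed_vector \<Rightarrow> 'b) \<Rightarrow> ('a::real_normed_vector \<Rightarrow>\<^sub>L 'b) \<Rightarrow> enat" where
  "operator_rank scaleF T = vector_space.edim scaleF (range (blinfun_apply T))"

end

theory Submission
  imports Defs
begin

text \<open>
  Let \<open>S\<close> and \<open>T\<close> have rank \<open>k\<close>. Their kernels have codimension \<open>k\<close>, so they have a common complement,
  spanned by vectors \<open>g\<^sub>0, \<dots>, g\<^sub>k\<^sub>-\<^sub>1\<close> (\<open>common_independent_images\<close>). The coordinates \<open>h\<^sub>i x\<close> of \<open>T x\<close> in
  the basis \<open>T g\<^sub>i\<close> of the range of \<open>T\<close> are bounded functionals with \<open>h\<^sub>i g\<^sub>j = \<delta>\<^sub>i\<^sub>j\<close>, and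
  \<open>T = \<Sum>\<^sub>i h\<^sub>i \<otimes> T g\<^sub>i\<close> (\<open>rank_operator_as_tensor_sum\<close>). The path from \<open>S\<close> to \<open>T\<close> consists of segments of
  two kinds.

  The first segment changes the kernel: it leads from \<open>S\<close> to \<open>\<Sum>\<^sub>i h\<^sub>i \<otimes> S g\<^sub>i\<close>. Both end points
  agree on the vectors \<open>g\<^sub>i\<close> and have the range of \<open>S\<close>, which is spanned by the \<open>S g\<^sub>i\<close>; so does every
  operator in between (\<open>path_component_change_kernel\<close>).

  The other segments change the range, with the \<open>h\<^sub>i\<close> fixed. The operator \<open>\<Sum>\<^sub>i h\<^sub>i \<otimes> e\<^sub>i\<close> has rank \<open>k\<close>
  whenever the \<open>e\<^sub>i\<close> are independent, so it remains to connect the independent families \<open>S g\<^sub>i\<close> and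
  \<open>T g\<^sub>i\<close> of \<open>F\<close>. If \<open>v\<close> lies outside the span of the \<open>e\<^sub>i\<close>, then one member can be moved to \<open>v\<close>
  along a segment without destroying independence (\<open>path_component_exchange\<close>). As \<open>k < dim F\<close>, such
  vectors always exist, and the positions can be set one after the other to their targets
  (\<open>exchange_connects\<close>). This is the step that uses the bound on \<open>k\<close>: over \<open>\<real>\<close>, when \<open>k = dim F > 0\<close>,
  the sign of the determinant separates the bases of \<open>F\<close> into two classes that no path connects.
\<close>

section \<open>Finite independent families\<close>

definition (in vector_space) independent_family :: "('i \<Rightarrow> 'b) \<Rightarrow> 'i set \<Rightarrow> bool" where
  "independent_family e I \<longleftrightarrow> inj_on e I \<and> independent (e ` I)"

lemma (in vector_space) independent_family_subset:
  "independent_family e I \<Longrightarrow> J \<subseteq> I \<Longrightarrow> independent_family e J"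
  unfolding independent_family_def
  by (meson image_mono independent_mono inj_on_subset)

lemma (in vector_space) independent_family_extend:
  assumes "independent_family e I" "j \<notin> I" "v \<notin> span (e ` I)"
  shows "independent_family (e(j := v)) (insert j I)"
proof -
  have eq: "(e(j := v)) ` I = e ` I"
    using assms(2) by auto
  have "v \<notin> e ` I"
    using assms(3) span_base by blast
  moreover have "inj_on (e(j := v)) I"
    using assms(1,2) unfolding independent_family_def inj_on_def by auto
  ultimately show ?thesis
    using assms eq by (auto simp: independent_family_def independent_insertI)
qed

lemma (in vector_space) independent_family_update:
  assumes "independent_family e I" "l \<in> I" "v \<notin> span (e ` (I - {l}))"
  shows "independent_family (e(l := v)) I"
  using independent_family_extend[of e "I - {l}" l v] assms independent_family_subset[of e I "I - {l}"]
  by (auto simp: insert_absorb)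

lemma (in vector_space) independent_family_not_in_span:
  assumes "independent_family e I" "l \<in> I" "J \<subseteq> I - {l}"
  shows "e l \<notin> span (e ` J)"
proof
  assume "e l \<in> span (e ` J)"
  moreover have "e ` J \<subseteq> e ` I - {e l}"
    using assms unfolding independent_family_def inj_on_def by blast
  ultimately have "e l \<in> span (e ` I - {e l})"
    using span_mono by blast
  then show False
    using assms(1,2) unfolding independent_family_def dependent_def by blast
qed

lemma (in vector_space) edim_span_independent_family:
  assumes "independent_family e {..<k}"
  shows "edim (span (e ` {..<k})) = enat k"
proof -
  have "dim (span (e ` {..<k})) = k"
    using assms unfolding independent_family_def
    by (simp add: dim_eq_card_independent card_image)
  then show ?thesis
    unfolding edim_def using finite_imageI[of "{..<k}" e] by auto
qed

lemma (in vector_space) edim_enatE: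
  assumes "edim V = enat k"
  obtains B where "finite B" "V \<subseteq> span B" "independent B" "B \<subseteq> V" "card B = k"
proof -
  obtain C where C: "finite C" "V \<subseteq> span C" and d: "dim V = k"
    using assms unfolding edim_def by (auto split: if_splits)
  obtain B where B: "B \<subseteq> V" "independent B" "V \<subseteq> span B" "card B = dim V"
    by (rule basis_exists)
  then have "finite B"
    using independent_span_bound C by blast
  with B d that show ?thesis by blast
qed

lemma (in vector_space) span_family_proper:
  fixes e :: "nat \<Rightarrow> 'b"
  assumes "enat j < edim V"
  shows "\<not> V \<subseteq> span (e ` {..<j})"
proof
  assume *: "V \<subseteq> span (e ` {..<j})"
  then have "dim V \<le> card (e ` {..<j})"
    by (rule dim_le_card) simp
  also have "\<dots> \<le> j"
    using card_image_le[of "{..<j}" e] by simp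
  finally have "edim V \<le> enat j"
    using * unfolding edim_def by auto
  with assms show False by simp
qed

text \<open>By the Steinitz bound, a family of full length in a finite-dimensional space spans it.\<close>

lemma (in vector_space) span_family_eq:
  assumes "independent_family e {..<k}" "edim V = enat k" "e ` {..<k} \<subseteq> V"
  shows "V \<subseteq> span (e ` {..<k})"
proof
  fix x assume x: "x \<in> V"
  show "x \<in> span (e ` {..<k})"
  proof (rule ccontr)
    assume "x \<notin> span (e ` {..<k})"
    then have ext: "independent_family (e(k := x)) {..<Suc k}"
      using independent_family_extend[OF assms(1)] by (simp add: lessThan_Suc)
    obtain B where B: "finite B" "V \<subseteq> span B" "card B = k"
      using edim_enatE[OF assms(2)] by metis
    have "(e(k := x)) ` {..<Suc k} \<subseteq> span B"
      using x assms(3) B(2) by (fastforce simp: less_Suc_eq)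
    then have "card ((e(k := x)) ` {..<Suc k}) \<le> card B"
      using independent_span_bound B(1) ext unfolding independent_family_def by blast
    then show False
      using ext B(3) card_image[of "e(k := x)" "{..<Suc k}"] by (simp add: independent_family_def del: fun_upd_image)
  qed
qed

text \<open>
  The new vector is required to lie outside the span of the whole family, the replaced member
  included, so that the family stays independent all along the segment from the old to the new
  member, see \<open>independent_family_segment\<close> below.
\<close>

definition (in vector_space) exchange :: "nat \<Rightarrow> (nat \<Rightarrow> 'b) \<Rightarrow> (nat \<Rightarrow> 'b) \<Rightarrow> bool" where
  "exchange k e e' \<longleftrightarrow> independent_family e {..<k} \<and>
     (\<exists>l<k. \<exists>v. v \<notin> span (e ` {..<k}) \<and> e' = e(l := v))"

lemma (in vector_space) exchangeI:
  "independent_family e {..<k} \<Longrightarrow> l < k \<Longrightarrow> v \<notin> span (e ` {..<k}) \<Longrightarrow> exchange k e (e(l := v))"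
  unfolding exchange_def by blast

lemma (in vector_space) not_in_span_subfamily:
  "v \<notin> span (e ` I) \<Longrightarrow> v \<notin> span (e ` (I - J))"
  by (meson Diff_subset image_mono span_mono subsetD)

lemma (in vector_space) exchange_independent:
  assumes "exchange k e e'"
  shows "independent_family e' {..<k}"
  using assms not_in_span_subfamily independent_family_update unfolding exchange_def by fastforce

text \<open>
  The target vector \<open>u\<close> cannot be moved in directly when it lies in the span of the family. Since
  \<open>k\<close> is smaller than the dimension, there is a vector \<open>w\<close> outside the span. Let \<open>e l\<close> be the last
  member that occurs in the expansion of \<open>u\<close>. Putting \<open>w\<close> at position \<open>l\<close> pushes \<open>u\<close> out of the
  span, after which \<open>u\<close> can be moved to position \<open>j\<close>. As \<open>u\<close> is independent of the members
  before \<open>j\<close>, the position \<open>l\<close> is at or after \<open>j\<close>, so that those members remain untouched.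
\<close>

lemma (in vector_space) exchange_position:
  assumes k: "enat k < edim UNIV" and e: "independent_family e {..<k}"
    and j: "j < k" and u: "u \<notin> span (e ` {..<j})"
  shows "\<exists>e'. (exchange k)\<^sup>*\<^sup>* e e' \<and> (\<forall>i<j. e' i = e i) \<and> e' j = u"
proof (cases "u \<in> span (e ` {..<k})")
  case False
  then have "exchange k e (e(j := u))"
    using exchangeI e j by blast
  then show ?thesis
    by (intro exI[of _ "e(j := u)"]) auto
next
  case True
  define m where "m = (LEAST m. u \<in> span (e ` {..<m}))"
  have m: "u \<in> span (e ` {..<m})" and mk: "m \<le> k"
    unfolding m_def by (rule LeastI[of _ k], fact True, rule Least_le, fact True)
  have "j < m"
    using m u span_mono[of "e ` {..<m}" "e ` {..<j}"] by (meson image_mono lessThan_subset_iff not_less subsetD)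
  then obtain l where l: "m = Suc l" "j \<le> l"
    by (cases m) auto
  have lk: "l < k"
    using l mk by simp
  have "u \<notin> span (e ` {..<l})"
    using not_less_Least[of l "\<lambda>m. u \<in> span (e ` {..<m})"] l unfolding m_def by simp
  then have el: "e l \<in> span (insert u (e ` {..<l}))"
    using in_span_insert m l by (simp add: lessThan_Suc)
  let ?R = "e ` ({..<k} - {l})"
  have uR: "u \<notin> span ?R"
  proof
    assume "u \<in> span ?R"
    moreover have "e ` {..<l} \<subseteq> span ?R"
      using lk by (auto intro!: span_base)
    ultimately have "span (insert u (e ` {..<l})) \<subseteq> span ?R"
      by (intro span_minimal) auto
    then show False
      using el independent_family_not_in_span[OF e, of l "{..<k} - {l}"] lk by auto
  qed
  obtain w where w: "w \<notin> span (e ` {..<k})"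
    using span_family_proper[OF k] by blast
  let ?e1 = "e(l := w)"
  have step1: "exchange k e ?e1"
    using exchangeI e lk w by blast
  have im: "?e1 ` {..<k} = insert w ?R"
    using lk by (auto simp: image_iff)
  have "u \<notin> span (?e1 ` {..<k})"
  proof
    assume "u \<in> span (?e1 ` {..<k})"
    then have "w \<in> span (insert u ?R)"
      using in_span_insert uR im by metis
    moreover have "span (insert u ?R) \<subseteq> span (e ` {..<k})"
      using True by (intro span_minimal) (auto intro!: span_base)
    ultimately show False
      using w by blast
  qed
  then have "exchange k ?e1 (?e1(j := u))"
    using exchangeI exchange_independent[OF step1] j by blast
  with step1 have "(exchange k)\<^sup>*\<^sup>* e (?e1(j := u))"
    by (meson converse_rtranclp_into_rtranclp r_into_rtranclp)
  then show ?thesis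
    using l(2) by (intro exI[of _ "?e1(j := u)"]) auto
qed

lemma (in vector_space) exchange_rtranclp_independent:
  assumes "(exchange k)\<^sup>*\<^sup>* e e'" "independent_family e {..<k}"
  shows "independent_family e' {..<k}"
  using assms by (induction rule: rtranclp_induct) (auto dest: exchange_independent)

lemma (in vector_space) exchange_connects:
  assumes k: "enat k < edim UNIV"
    and e: "independent_family e {..<k}" and e': "independent_family e' {..<k}"
  shows "\<exists>d. (exchange k)\<^sup>*\<^sup>* e d \<and> (\<forall>i<k. d i = e' i)"
proof -
  have "\<exists>d. (exchange k)\<^sup>*\<^sup>* e d \<and> (\<forall>i<j. d i = e' i)" if "j \<le> k" for j
    using that
  proof (induction j)
    case 0
    then show ?case by auto
  next
    case (Suc j)
    then obtain d where d: "(exchange k)\<^sup>*\<^sup>* e d" "\<forall>i<j. d i = e' i"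
      by auto
    have "d ` {..<j} = e' ` {..<j}"
      using d(2) by auto
    moreover have "{..<j} \<subseteq> {..<k} - {j}"
      using Suc.prems by auto
    ultimately have "e' j \<notin> span (d ` {..<j})"
      using independent_family_not_in_span[OF e', of j "{..<j}"] Suc.prems by simp
    then obtain c where "(exchange k)\<^sup>*\<^sup>* d c" "\<forall>i<j. c i = d i" "c j = e' j"
      using exchange_position[OF k exchange_rtranclp_independent[OF d(1) e], of j] Suc.prems by auto
    with d show ?case
      by (intro exI[of _ c]) (auto simp: less_Suc_eq)
  qed
  then show ?thesis by blast
qed

lemma (in vector_space) avoid_two_subspaces:
  assumes A: "subspace A" "A \<noteq> UNIV" and B: "subspace B" "B \<noteq> UNIV"
  obtains x where "x \<notin> A" "x \<notin> B"
proof -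
  obtain a b where ab: "a \<notin> A" "b \<notin> B"
    using A B by blast
  \<comment> \<open>If neither \<open>a\<close> nor \<open>b\<close> serves, then \<open>a\<close> lies in \<open>B\<close> only and \<open>b\<close> in \<open>A\<close> only, so \<open>a + b\<close> is in neither.\<close>
  show ?thesis
  proof (cases "a \<in> B \<and> b \<in> A")
    case True
    then have "a + b \<notin> A" "a + b \<notin> B"
      using ab subspace_diff[OF A(1), of "a + b" b] subspace_diff[OF B(1), of "a + b" a] by auto
    then show ?thesis using that by blast
  qed (use ab that in blast)
qed


section \<open>Finite-dimensional subspaces of a Banach space\<close>

context banach_space_over
begin

lemma bounded_bilinear_scale: "bounded_bilinear scale"
proof
  fix r :: real and a :: 'k and b :: 'a
  have *: "r *\<^sub>R x = scale (of_real r) x" for x :: 'a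
    by (simp add: scale_of_real)
  show "scale (r *\<^sub>R a) b = r *\<^sub>R scale a b"
    by (simp add: * scaleR_conv_of_real)
  show "scale a (r *\<^sub>R b) = r *\<^sub>R scale a b"
    by (simp add: * mult.commute)
  show "\<exists>K. \<forall>a b. norm (scale a b) \<le> norm a * norm b * K"
    by (intro exI[of _ 1]) (simp add: norm_scale)
qed (simp_all add: scale_left_distrib scale_right_distrib)

lemma subspace_scaleR: "subspace S \<Longrightarrow> x \<in> S \<Longrightarrow> r *\<^sub>R x \<in> S"
  using subspace_scale[of S x "of_real r"] by (simp add: scale_of_real)

text \<open>For \<open>c \<noteq> 0\<close>, the vector \<open>y\<close> is \<open>c\<close> times the difference of \<open>a\<close> and an element of \<open>S\<close>.\<close>

lemma coefficient_bound:
  assumes S: "subspace S" and y: "y - scale c a \<in> S"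
  shows "norm c * infdist a S \<le> norm y"
proof (cases "c = 0")
  case False
  define s where "s = scale (inverse c) (y - scale c a)"
  have s: "s \<in> S"
    unfolding s_def using S y by (rule subspace_scale)
  have "y = scale c (a + s)"
    using False by (simp add: s_def scale_right_distrib scale_right_diff_distrib)
  then have "norm y = norm c * dist a (- s)"
    by (simp add: norm_scale dist_norm)
  moreover have "infdist a S \<le> dist a (- s)"
    using s S by (intro infdist_le subspace_neg)
  ultimately show ?thesis
    by (simp add: mult_left_mono)
qed simp

text \<open>
  When a vector \<open>a\<close> outside \<open>span B\<close> is added, it has positive distance from \<open>span B\<close> by the induction
  hypothesis. Hence the coefficients of \<open>a\<close> along a convergent sequence form a Cauchy sequence of
  scalars, and subtracting their limit leads back to \<open>span B\<close>.
\<close>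

lemma closed_span_finite:
  assumes "finite B"
  shows "closed (span B)"
  using assms
proof induction
  case (insert a B)
  show ?case
  proof (cases "a \<in> span B")
    case True
    then show ?thesis
      using insert by (simp add: span_redundant)
  next
    case False
    define d where "d = infdist a (span B)"
    have d: "d > 0"
      unfolding d_def using False insert span_zero
      by (intro infdist_pos_not_in_closed) auto
    show ?thesis
      unfolding closed_sequential_limits
    proof safe
      fix y l
      assume "\<forall>n. y n \<in> span (insert a B)" and lim: "y \<longlonglongrightarrow> l"
      then obtain c where c: "\<And>n. y n - scale (c n) a \<in> span B"
        unfolding span_breakdown_eq by metis
      have bound: "norm (c m - c n) * d \<le> norm (y m - y n)" for m n
      proof -
        have "(y m - scale (c m) a) - (y n - scale (c n) a) \<in> span B"
          using span_diff[OF c c] .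
        then have "(y m - y n) - scale (c m - c n) a \<in> span B"
          by (simp add: scale_left_diff_distrib algebra_simps)
        then show ?thesis
          unfolding d_def by (intro coefficient_bound) auto
      qed
      have "Cauchy c"
      proof (rule CauchyI)
        fix r :: real assume "r > 0"
        then obtain N where N: "\<forall>m\<ge>N. \<forall>n\<ge>N. norm (y m - y n) < r * d"
          using CauchyD[OF LIMSEQ_imp_Cauchy[OF lim], of "r * d"] d by auto
        have "norm (c m - c n) < r" if "m \<ge> N" "n \<ge> N" for m n
          using N that bound[of m n] d by (meson le_less_trans mult_less_cancel_right_pos)
        then show "\<exists>M. \<forall>m\<ge>M. \<forall>n\<ge>M. norm (c m - c n) < r"
          by blast
      qed
      then obtain t where t: "c \<longlonglongrightarrow> t"
        using Cauchy_convergent convergent_def by blast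
      have "(\<lambda>n. y n - scale (c n) a) \<longlonglongrightarrow> l - scale t a"
        by (rule tendsto_diff[OF lim bounded_bilinear.tendsto[OF bounded_bilinear_scale t tendsto_const]])
      then have "l - scale t a \<in> span B"
        by (rule closed_sequentially[OF insert.IH c])
      then show "l \<in> span (insert a B)"
        unfolding span_breakdown_eq by blast
    qed
  qed
qed simp

text \<open>The bound is the inverse of the distance from \<open>b\<close> to the span of the other basis vectors.\<close>

lemma representation_bounded:
  assumes "finite B" "independent B" "b \<in> B"
  shows "\<exists>K\<ge>0. \<forall>x \<in> span B. norm (representation B x b) \<le> norm x * K"
proof -
  let ?S = "span (B - {b})"
  define d where "d = infdist b ?S"
  have "b \<notin> ?S"
    using assms(2,3) unfolding dependent_def by blast
  then have d: "d > 0"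
    unfolding d_def using assms(1) closed_span_finite[of "B - {b}"] span_zero
    by (intro infdist_pos_not_in_closed) auto
  have "norm (representation B x b) \<le> norm x * inverse d" if x: "x \<in> span B" for x
  proof -
    have "x = (\<Sum>a\<in>B. scale (representation B x a) a)"
      using sum_representation_eq[OF assms(2) x assms(1)] by simp
    also have "\<dots> = scale (representation B x b) b + (\<Sum>a\<in>B - {b}. scale (representation B x a) a)"
      using assms by (simp add: sum.remove)
    finally have "x - scale (representation B x b) b = (\<Sum>a\<in>B - {b}. scale (representation B x a) a)"
      by (simp add: algebra_simps)
    also have "\<dots> \<in> ?S"
      by (intro span_sum span_scale span_base)
    finally have "norm (representation B x b) * d \<le> norm x"
      unfolding d_def by (intro coefficient_bound) auto
    then show ?thesis
      using d by (simp add: field_simps)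
  qed
  moreover have "inverse d \<ge> 0"
    using d by simp
  ultimately show ?thesis by blast
qed

text \<open>
  If a point of the segment with \<open>t \<noteq> 0\<close> were in the span of the other members, then solving for \<open>v\<close>
  would put \<open>v\<close> into the span of the whole family.
\<close>

lemma independent_family_segment:
  assumes e: "independent_family e I" and l: "l \<in> I" and v: "v \<notin> span (e ` I)"
  shows "independent_family (e(l := (1 - t) *\<^sub>R e l + t *\<^sub>R v)) I"
proof (cases "t = 0")
  case False
  have "(1 - t) *\<^sub>R e l + t *\<^sub>R v \<notin> span (e ` I)"
  proof
    assume "(1 - t) *\<^sub>R e l + t *\<^sub>R v \<in> span (e ` I)"
    moreover have "(1 - t) *\<^sub>R e l \<in> span (e ` I)"
      using l by (intro subspace_scaleR) (auto intro: span_base)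
    ultimately have "t *\<^sub>R v \<in> span (e ` I)"
      using span_diff by fastforce
    then have "inverse t *\<^sub>R t *\<^sub>R v \<in> span (e ` I)"
      by (rule subspace_scaleR[OF subspace_span])
    moreover have "inverse t *\<^sub>R t *\<^sub>R v = v"
      using False by simp
    ultimately show False
      using v by simp
  qed
  then show ?thesis
    by (rule independent_family_update[OF e l not_in_span_subfamily])
qed (use e in simp)

end


section \<open>Operators of finite rank\<close>

locale banach_space_pair = E: banach_space_over scaleE + F: banach_space_over scaleF
  for scaleE :: "'k::{real_normed_field,euclidean_space} \<Rightarrow> 'e::banach \<Rightarrow> 'e"
    and scaleF :: "'k \<Rightarrow> 'f::banach \<Rightarrow> 'f"
begin

definition rank_operators :: "nat \<Rightarrow> ('e \<Rightarrow>\<^sub>L 'f) set" where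
  "rank_operators k = {T \<in> bounded_operators scaleE scaleF. operator_rank scaleF T = enat k}"

lemma bounded_operators_iff:
  "T \<in> bounded_operators scaleE scaleF \<longleftrightarrow> (\<forall>c x. T (scaleE c x) = scaleF c (T x))"
  unfolding bounded_operators_def Vector_Spaces.linear_iff
  using E.vector_space_axioms F.vector_space_axioms by (simp add: blinfun.add_right)

lemma bounded_operators_segment:
  assumes "S \<in> bounded_operators scaleE scaleF" "T \<in> bounded_operators scaleE scaleF"
  shows "(1 - t) *\<^sub>R S + t *\<^sub>R T \<in> bounded_operators scaleE scaleF"
  using assms bounded_bilinear.scaleR_right[OF F.bounded_bilinear_scale]
  by (simp add: bounded_operators_iff blinfun.add_left blinfun.scaleR_left F.scale_right_distrib)

lemma bounded_operators_linear:
  assumes "T \<in> bounded_operators scaleE scaleF"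
  shows "module_hom scaleE scaleF (blinfun_apply T)"
  using assms Vector_Spaces.linear.axioms(3) unfolding bounded_operators_def by blast

lemma subspace_range:
  assumes "T \<in> bounded_operators scaleE scaleF"
  shows "F.subspace (range (blinfun_apply T))"
  using module_hom.subspace_image[OF bounded_operators_linear[OF assms]] E.subspace_UNIV by blast

text \<open>
  The range is squeezed: it contains the values \<open>e i\<close>, hence their span, and is contained in it.
\<close>

lemma rank_operatorsI:
  assumes T: "T \<in> bounded_operators scaleE scaleF"
    and e: "F.independent_family e {..<k}"
    and g: "\<And>i. i < k \<Longrightarrow> T (g i) = e i"
    and ran: "\<And>x. T x \<in> F.span (e ` {..<k})"
  shows "T \<in> rank_operators k"
proof -
  have "e ` {..<k} \<subseteq> range T"
    using g by (metis image_subsetI lessThan_iff rangeI)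
  then have "range T = F.span (e ` {..<k})"
    using ran F.span_minimal[OF _ subspace_range[OF T]] by blast
  then show ?thesis
    using T F.edim_span_independent_family[OF e]
    by (simp add: rank_operators_def operator_rank_def)
qed

text \<open>
  The preimage of the span of fewer than \<open>k\<close> images is a proper subspace of \<open>E\<close>. Avoiding the two
  preimages that belong to \<open>S\<close> and \<open>T\<close> yields the next vector; in the end \<open>g\<close> spans a common
  complement of the two kernels.
\<close>

lemma common_independent_images:
  assumes S: "S \<in> rank_operators k" and T: "T \<in> rank_operators k"
  shows "\<exists>g. F.independent_family (\<lambda>i. S (g i)) {..<k} \<and> F.independent_family (\<lambda>i. T (g i)) {..<k}"
proof -
  have sub: "E.subspace {x. R x \<in> F.span V}" if "R \<in> rank_operators k" for R V
    using that module_hom.subspace_vimage[OF bounded_operators_linear, of R "F.span V"]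
    by (simp add: rank_operators_def vimage_def)
  have proper: "{x. R x \<in> F.span ((\<lambda>i. R (g i)) ` {..<j})} \<noteq> UNIV"
    if "R \<in> rank_operators k" "j < k" for R j and g :: "nat \<Rightarrow> 'e"
    using that F.span_family_proper[of j "range R" "\<lambda>i. R (g i)"]
    by (auto simp: rank_operators_def operator_rank_def)
  have "\<exists>g. F.independent_family (\<lambda>i. S (g i)) {..<j} \<and> F.independent_family (\<lambda>i. T (g i)) {..<j}"
    if "j \<le> k" for j
    using that
  proof (induction j)
    case 0
    then show ?case
      by (simp add: F.independent_family_def F.independent_empty)
  next
    case (Suc j)
    then obtain g where g: "F.independent_family (\<lambda>i. S (g i)) {..<j}"
        "F.independent_family (\<lambda>i. T (g i)) {..<j}"
      by auto
    have "j < k"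
      using Suc.prems by simp
    then obtain x where "x \<notin> {x. S x \<in> F.span ((\<lambda>i. S (g i)) ` {..<j})}"
        "x \<notin> {x. T x \<in> F.span ((\<lambda>i. T (g i)) ` {..<j})}"
      using E.avoid_two_subspaces[OF sub[OF S] proper[OF S] sub[OF T] proper[OF T]] by metis
    then have x: "S x \<notin> F.span ((\<lambda>i. S (g i)) ` {..<j})" "T x \<notin> F.span ((\<lambda>i. T (g i)) ` {..<j})"
      by auto
    have eq: "(\<lambda>i. R ((g(j := x)) i)) = (\<lambda>i. R (g i))(j := R x)" for R :: "'e \<Rightarrow>\<^sub>L 'f"
      by auto
    have "F.independent_family ((\<lambda>i. S (g i))(j := S x)) {..<Suc j}"
        "F.independent_family ((\<lambda>i. T (g i))(j := T x)) {..<Suc j}"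
      using F.independent_family_extend[OF g(1) _ x(1), of j] F.independent_family_extend[OF g(2) _ x(2), of j]
      by (simp_all add: lessThan_Suc)
    then show ?case
      unfolding eq[symmetric] by blast
  qed
  then show ?thesis by blast
qed

definition dual_functionals :: "nat \<Rightarrow> (nat \<Rightarrow> 'e) \<Rightarrow> (nat \<Rightarrow> 'e \<Rightarrow> 'k) \<Rightarrow> bool" where
  "dual_functionals k g h \<longleftrightarrow>
     (\<forall>i<k. bounded_linear (h i) \<and> (\<forall>c x. h i (scaleE c x) = c * h i x)
        \<and> (\<forall>j<k. h i (g j) = (if i = j then 1 else 0)))"

definition tensor_sum :: "nat \<Rightarrow> (nat \<Rightarrow> 'e \<Rightarrow> 'k) \<Rightarrow> (nat \<Rightarrow> 'f) \<Rightarrow> 'e \<Rightarrow>\<^sub>L 'f" where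
  "tensor_sum k h e = Blinfun (\<lambda>x. \<Sum>i<k. scaleF (h i x) (e i))"

lemma tensor_sum_apply:
  assumes "dual_functionals k g h"
  shows "tensor_sum k h e x = (\<Sum>i<k. scaleF (h i x) (e i))"
proof -
  have "bounded_linear (\<lambda>x. \<Sum>i<k. scaleF (h i x) (e i))"
    using assms unfolding dual_functionals_def
    by (intro bounded_linear_sum bounded_linear_compose[OF
          bounded_bilinear.bounded_linear_left[OF F.bounded_bilinear_scale]]) auto
  then show ?thesis
    by (simp add: tensor_sum_def bounded_linear_Blinfun_apply)
qed

lemma tensor_sum_bounded_operator:
  assumes "dual_functionals k g h"
  shows "tensor_sum k h e \<in> bounded_operators scaleE scaleF"
  using assms
  by (auto simp: bounded_operators_iff tensor_sum_apply[OF assms] dual_functionals_def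
      F.scale_sum_right intro!: sum.cong)

lemma tensor_sum_dual:
  assumes "dual_functionals k g h" "j < k"
  shows "tensor_sum k h e (g j) = e j"
proof -
  have "tensor_sum k h e (g j) = (\<Sum>i<k. if i = j then e j else 0)"
    using assms unfolding tensor_sum_apply[OF assms(1)] dual_functionals_def
    by (intro sum.cong) auto
  then show ?thesis
    using assms(2) by simp
qed

lemma tensor_sum_range:
  assumes "dual_functionals k g h"
  shows "tensor_sum k h e x \<in> F.span (e ` {..<k})"
  unfolding tensor_sum_apply[OF assms]
  by (intro F.span_sum F.span_scale F.span_base) auto

lemma tensor_sum_rank:
  assumes "dual_functionals k g h" "F.independent_family e {..<k}"
  shows "tensor_sum k h e \<in> rank_operators k"
  using tensor_sum_bounded_operator[OF assms(1)] assms(2) tensor_sum_dual[OF assms(1)]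
    tensor_sum_range[OF assms(1)] by (rule rank_operatorsI)

text \<open>
  The functionals are the coordinates of \<open>T x\<close> in the basis \<open>T (g i)\<close> of the range of \<open>T\<close>. They are
  bounded because coordinates on a finite-dimensional space are.
\<close>

lemma rank_operator_as_tensor_sum:
  assumes T: "T \<in> rank_operators k" and ind: "F.independent_family (\<lambda>i. T (g i)) {..<k}"
  obtains h where "dual_functionals k g h" "tensor_sum k h (\<lambda>i. T (g i)) = T"
proof -
  let ?e = "\<lambda>i. T (g i)" and ?B = "(\<lambda>i. T (g i)) ` {..<k}"
  define h where "h i x = F.representation ?B (T x) (?e i)" for i x
  have Tb: "T \<in> bounded_operators scaleE scaleF" and rk: "F.edim (range T) = enat k"
    using T by (auto simp: rank_operators_def operator_rank_def)
  have inj: "inj_on ?e {..<k}" and B: "F.independent ?B"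
    using ind by (auto simp: F.independent_family_def)
  have sp: "T x \<in> F.span ?B" for x
    using F.span_family_eq[OF ind rk] by auto
  have scale: "h i (scaleE c x) = c * h i x" for i c x
    using Tb by (simp add: h_def bounded_operators_iff F.representation_scale[OF B sp])
  have blin: "bounded_linear (h i)" if "i < k" for i
  proof -
    have "?e i \<in> ?B"
      using that by simp
    then obtain K where K: "K \<ge> 0" "\<forall>y \<in> F.span ?B. norm (F.representation ?B y (?e i)) \<le> norm y * K"
      using F.representation_bounded[OF finite_imageI[OF finite_lessThan] B, of "?e i"] by blast
    show ?thesis
    proof (rule bounded_linear_intro)
      show "h i (x + y) = h i x + h i y" for x y
        by (simp add: h_def blinfun.add_right F.representation_add[OF B sp sp])
      show "h i (r *\<^sub>R x) = r *\<^sub>R h i x" for r x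
        using scale[of i "of_real r" x] by (simp add: E.scale_of_real scaleR_conv_of_real)
      show "norm (h i x) \<le> norm x * (norm T * K)" for x
      proof -
        have "norm (h i x) \<le> norm (T x) * K"
          using K(2) sp by (simp add: h_def)
        also have "\<dots> \<le> (norm T * norm x) * K"
          by (intro mult_right_mono norm_blinfun K(1))
        finally show ?thesis by (simp add: ac_simps)
      qed
    qed
  qed
  have dual: "dual_functionals k g h"
    unfolding dual_functionals_def
  proof (intro allI impI conjI)
    fix i j assume "i < k" "j < k"
    then show "h i (g j) = (if i = j then 1 else 0)"
      using inj F.representation_basis[OF B, of "?e j"] unfolding h_def inj_on_def by auto
  qed (use blin scale in auto)
  have "tensor_sum k h ?e x = T x" for x
  proof -
    have "tensor_sum k h ?e x = (\<Sum>b\<in>?B. scaleF (F.representation ?B (T x) b) b)"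
      using inj by (simp add: tensor_sum_apply[OF dual] h_def sum.reindex)
    also have "\<dots> = T x"
      using F.sum_representation_eq[OF B sp] by simp
    finally show ?thesis .
  qed
  then have "tensor_sum k h ?e = T"
    by (intro blinfun_eqI) simp
  with dual that show ?thesis by blast
qed

lemma path_component_segment:
  assumes "\<And>t. 0 \<le> t \<Longrightarrow> t \<le> 1 \<Longrightarrow> (1 - t) *\<^sub>R S + t *\<^sub>R T \<in> A"
  shows "path_component A S (T :: 'e \<Rightarrow>\<^sub>L 'f)"
  using assms by (intro path_component_linepath) (auto simp: closed_segment_def)

text \<open>
  The kernel of \<open>tensor_sum k h e\<close> is the common kernel of the \<open>h i\<close>, for every independent \<open>e\<close>. All
  operators on the segment have range inside the range of \<open>S\<close> and agree with \<open>S\<close> on the vectors \<open>g i\<close>,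
  so that their range is constant.
\<close>

lemma path_component_change_kernel:
  assumes S: "S \<in> rank_operators k" and ind: "F.independent_family (\<lambda>i. S (g i)) {..<k}"
    and h: "dual_functionals k g h"
  shows "path_component (rank_operators k) S (tensor_sum k h (\<lambda>i. S (g i)))"
proof (rule path_component_segment)
  fix t :: real
  let ?e = "\<lambda>i. S (g i)"
  let ?R = "(1 - t) *\<^sub>R S + t *\<^sub>R tensor_sum k h ?e"
  have Sb: "S \<in> bounded_operators scaleE scaleF" and rk: "F.edim (range S) = enat k"
    using S by (auto simp: rank_operators_def operator_rank_def)
  have "?R \<in> bounded_operators scaleE scaleF"
    by (rule bounded_operators_segment[OF Sb tensor_sum_bounded_operator[OF h]])
  moreover have "?R (g i) = ?e i" if "i < k" for i
    using tensor_sum_dual[OF h that, of ?e]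
    by (simp add: blinfun.add_left blinfun.scaleR_left flip: scaleR_left_distrib)
  moreover have "?R x \<in> F.span (?e ` {..<k})" for x
  proof -
    have "S x \<in> F.span (?e ` {..<k})"
      using F.span_family_eq[OF ind rk] by auto
    then show ?thesis
      unfolding blinfun.add_left blinfun.scaleR_left
      using tensor_sum_range[OF h]
      by (intro F.span_add F.subspace_scaleR[OF F.subspace_span])
  qed
  ultimately show "?R \<in> rank_operators k"
    using ind by (intro rank_operatorsI)
qed

lemma path_component_exchange:
  assumes h: "dual_functionals k g h" and ex: "F.exchange k e e'"
  shows "path_component (rank_operators k) (tensor_sum k h e) (tensor_sum k h e')"
proof (rule path_component_segment)
  fix t :: real
  obtain l v where e: "F.independent_family e {..<k}" and l: "l < k"
    and v: "v \<notin> F.span (e ` {..<k})" and e': "e' = e(l := v)"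
    using ex unfolding F.exchange_def by blast
  let ?et = "e(l := (1 - t) *\<^sub>R e l + t *\<^sub>R v)"
  have et: "?et i = (1 - t) *\<^sub>R e i + t *\<^sub>R e' i" for i
    by (simp add: e' flip: scaleR_left_distrib)
  have "(1 - t) *\<^sub>R tensor_sum k h e + t *\<^sub>R tensor_sum k h e' = tensor_sum k h ?et"
    by (rule blinfun_eqI)
      (simp only: et blinfun.add_left blinfun.scaleR_left tensor_sum_apply[OF h] scaleR_sum_right
        F.scale_right_distrib bounded_bilinear.scaleR_right[OF F.bounded_bilinear_scale] sum.distrib)
  then show "(1 - t) *\<^sub>R tensor_sum k h e + t *\<^sub>R tensor_sum k h e' \<in> rank_operators k"
    using tensor_sum_rank[OF h F.independent_family_segment[OF e _ v, of l t]] l by simp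
qed

lemma path_component_exchange_rtranclp:
  assumes h: "dual_functionals k g h" and ex: "(F.exchange k)\<^sup>*\<^sup>* e e'"
    and e: "F.independent_family e {..<k}"
  shows "path_component (rank_operators k) (tensor_sum k h e) (tensor_sum k h e')"
  using ex
proof (induction rule: rtranclp_induct)
  case base
  then show ?case
    using tensor_sum_rank[OF h e] by (simp add: path_component_refl)
next
  case (step y z)
  then show ?case
    using path_component_exchange[OF h] path_component_trans by blast
qed

lemma path_connected_rank_operators:
  assumes k: "enat k < F.edim UNIV"
  shows "path_connected (rank_operators k)"
  unfolding path_connected_component
proof (intro ballI)
  fix S T assume S: "S \<in> rank_operators k" and T: "T \<in> rank_operators k"
  obtain g where Sg: "F.independent_family (\<lambda>i. S (g i)) {..<k}"
    and Tg: "F.independent_family (\<lambda>i. T (g i)) {..<k}"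
    using common_independent_images[OF S T] by blast
  obtain h where h: "dual_functionals k g h" and Th: "tensor_sum k h (\<lambda>i. T (g i)) = T"
    using rank_operator_as_tensor_sum[OF T Tg] .
  obtain d where d: "(F.exchange k)\<^sup>*\<^sup>* (\<lambda>i. S (g i)) d" "\<forall>i<k. d i = T (g i)"
    using F.exchange_connects[OF k Sg Tg] by blast
  have "tensor_sum k h d = tensor_sum k h (\<lambda>i. T (g i))"
    using d(2) by (simp add: tensor_sum_def)
  also note Th
  finally have "path_component (rank_operators k) (tensor_sum k h (\<lambda>i. S (g i))) T"
    using path_component_exchange_rtranclp[OF h d(1) Sg] by simp
  then show "path_component (rank_operators k) S T"
    using path_component_change_kernel[OF S Sg h] path_component_trans by blast
qed

end

theorem theorem2p3:
  fixes scaleE :: "'k::{real_normed_field,euclidean_space} \<Rightarrow> 'e::banach \<Rightarrow> 'e"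
    and scaleF :: "'k \<Rightarrow> 'f::banach \<Rightarrow> 'f"
    and k :: nat
  assumes "banach_space_over scaleE"
    and "banach_space_over scaleF"
    and "enat k < vector_space.edim scaleF (UNIV :: 'f set)"
  shows "path_connected {T \<in> bounded_operators scaleE scaleF. operator_rank scaleF T = enat k}"
proof -
  interpret banach_space_pair scaleE scaleF
    using assms(1,2) by (simp add: banach_space_pair_def)
  show ?thesis
    using path_connected_rank_operators[OF assms(3)] by (simp add: rank_operators_def)
qed

end
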